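(* There is an absolute constant $c$ such that for every integer $k\ge 1$ there is $d_k$ (depending only on $k$) such that for every $n$ there exist randomized formulas $\mathbf F_{a,b}$, $a,b\in[n]$, each of depth at most $d_k$ and size at most $n^{\frac13\log_\varphi(k)+c}$, where $\varphi=(\sqrt5+1)/2$, which compute the product of $k$ permutation matrices: for every input $(Q_1,\dots,Q_k)$ of $n\times n$ permutation matrices and every $a,b\in[n]$, with probability $1-o(1)$ (as $n\to\infty$) $\mathbf F_{a,b}$ outputs the $(a,b)$ entry of $Q_1Q_2\cdots Q_k$.
   Context: Formulas are Boolean formulas over the basis of unbounded fan-in AND, unbounded fan-in OR, and NOT; size is the number of gates. The input $(Q_1,\dots,Q_k)$ is given as $kn^2$ Boolean variables (the entries of the matrices). A randomized formula is a probability distribution over formulas; its output on an input is a random bit. (In the paper's terminology these are "randomized $\mathsf{AC}^0$ formulas", i.e. of depth bounded independently of $n$.) *)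

theory Defs
  imports "HOL-Probability.Probability_Mass_Function" "Jordan_Normal_Form.Matrix"
begin

text \<open>
  Boolean formulas over unbounded fan-in AND and OR, and NOT, with variables of type \<open>'v\<close>.
  Fan-in 0 is allowed and yields the Boolean constants.
\<close>

datatype (fvars: 'v) formula =
    Var 'v
  | Not "'v formula"
  | And "'v formula list"
  | Or "'v formula list"

fun eval_formula :: "('v \<Rightarrow> bool) \<Rightarrow> 'v formula \<Rightarrow> bool" where
  "eval_formula s (Var v) = s v"
| "eval_formula s (Not f) = (\<not> eval_formula s f)"
| "eval_formula s (And fs) = (\<forall>f\<in>set fs. eval_formula s f)"
| "eval_formula s (Or fs) = (\<exists>f\<in>set fs. eval_formula s f)"

text \<open>
  The datatype package's own \<open>size\<close> also counts variables and list cells, so the number of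
  gates is defined separately. Constants (gates of fan-in 0) and negations count as gates,
  variables do not.
\<close>

fun gates :: "'v formula \<Rightarrow> nat" where
  "gates (Var v) = 0"
| "gates (Not f) = Suc (gates f)"
| "gates (And fs) = Suc (\<Sum>f\<leftarrow>fs. gates f)"
| "gates (Or fs) = Suc (\<Sum>f\<leftarrow>fs. gates f)"

text \<open>The maximal number of gates, of any kind, on a path from the output to a leaf.\<close>

fun depth :: "'v formula \<Rightarrow> nat" where
  "depth (Var v) = 0"
| "depth (Not f) = Suc (depth f)"
| "depth (And fs) = Suc (Max (insert 0 (depth ` set fs)))"
| "depth (Or fs) = Suc (Max (insert 0 (depth ` set fs)))"

type_synonym 'v rformula = "'v formula pmf"

definition prob_outputs :: "'v rformula \<Rightarrow> ('v \<Rightarrow> bool) \<Rightarrow> bool \<Rightarrow> real" where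
  "prob_outputs F s b = measure_pmf.prob F {f. eval_formula s f = b}"

definition permutation_mat :: "nat \<Rightarrow> int mat \<Rightarrow> bool" where
  "permutation_mat n Q \<longleftrightarrow> Q \<in> carrier_mat n n \<and>
     (\<forall>i<n. \<forall>j<n. Q $$ (i, j) \<in> {0, 1}) \<and>
     (\<forall>i<n. \<exists>!j. j < n \<and> Q $$ (i, j) = 1) \<and>
     (\<forall>j<n. \<exists>!i. i < n \<and> Q $$ (i, j) = 1)"

definition mat_product :: "nat \<Rightarrow> int mat list \<Rightarrow> int mat" where
  "mat_product n Qs = foldr (*) Qs (1\<^sub>m n)"

text \<open>
  The variable \<open>(i, r, c)\<close> stands for entry \<open>(r, c)\<close> of the \<open>i\<close>-th matrix. Matrices, rows and
  columns are all numbered from 0.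
\<close>

type_synonym entry = "nat \<times> nat \<times> nat"

definition entries :: "nat \<Rightarrow> nat \<Rightarrow> entry set" where
  "entries k n = {..<k} \<times> {..<n} \<times> {..<n}"

definition input_bits :: "int mat list \<Rightarrow> entry \<Rightarrow> bool" where
  "input_bits Qs = (\<lambda>(i, r, c). (Qs ! i) $$ (r, c) = 1)"

definition golden_ratio :: real where
  "golden_ratio = (sqrt 5 + 1) / 2"

end

theory Submission
  imports Defs "HOL-Number_Theory.Fib" "HOL-Probability.Product_PMF" "HOL-Real_Asymp.Real_Asymp"
begin

text \<open>
  The permutations define \<open>n\<close> disjoint walks through the layers. Colour every layer randomly with
  \<open>m = n^(1/3 + o(1))\<close> colours: prescribing the colours in three different layers then leaves only
  boundedly many walks, with high probability. The formulas decide whether some walk meets given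
  monochromatic sets in three layers. If four layers are consecutive with gaps \<open>a, b, a\<close>, the walks
  through sets in the first, one middle and the last layer are found by guessing the colour in the
  other middle layer, at the price of a factor \<open>m\<close>, and joining the first three with the last
  three layers. The two sides of the join must agree on a walk; as only boundedly many walks are
  involved, this can be verified by hashing, at the price of a polylogarithmic factor. Each step
  replaces the gaps \<open>(a, b)\<close> by \<open>(a + b, a)\<close>, so the length grows by \<open>\<phi>\<close> for every factor
  \<open>n^(1/3)\<close>. The product is padded with identities to length \<open>fib (t + 3)\<close>.
\<close>

subsection \<open>The formulas\<close>

text \<open>The colouring \<open>h\<close>, with \<open>h (p, v)\<close> the colour of vertex
  \<open>v\<close> in layer \<open>p\<close>, is a fixed parameter here, so the formulas are
  deterministic; randomness enters only by drawing \<open>h\<close>. There are \<open>m\<close>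
  colours, vertices are hashed through \<open>l\<close> bits, and \<open>r\<close> is the number of
  bit positions in one hash.\<close>

locale walk_formulas =
  fixes k n m l r :: nat and h :: "nat \<times> nat \<Rightarrow> nat"
begin

text \<open>From layer \<open>k\<close> on every step is the identity: this is the padding to
  Fibonacci length, realised by the constants true (\<open>And []\<close>) and false
  (\<open>Or []\<close>).\<close>

definition edge :: "nat \<Rightarrow> nat \<Rightarrow> nat \<Rightarrow> entry formula" where
  "edge i u v = (if i < k then Var (i, u, v) else if u = v then And [] else Or [])"

definition vertices :: "nat set \<Rightarrow> nat list" where
  "vertices A = filter (\<lambda>v. v \<in> A) [0..<n]"

text \<open>Brute force over vertex triples serves for the base case, where both gaps are 1. Its
  cubic size enters the total as a single factor and goes into the additive constant of the
  exponent.\<close>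

definition short_formula :: "nat \<Rightarrow> nat set \<Rightarrow> nat set \<Rightarrow> nat set \<Rightarrow> entry formula" where
  "short_formula p A B C = Or (map (\<lambda>(u, v, w). And [edge p u v, edge (Suc p) v w])
     (List.product (vertices A) (List.product (vertices B) (vertices C))))"

text \<open>\<open>c\<close> is the guessed colour and \<open>d\<close> the guessed hash value, that
  is, the bits at the positions \<open>J\<close>. Fixing the colour keeps the sets passed down the
  recursion monochromatic.\<close>

definition fiber :: "nat \<Rightarrow> nat \<Rightarrow> nat list \<Rightarrow> bool list \<Rightarrow> nat set" where
  "fiber p c J d = {v. h (p, v) = c \<and> map (bit v) J = d}"

text \<open>The conjunction over the lists of bit positions separates the at most \<open>r\<close> pairs of
  vertices that could give a false positive; each of the pairs gets one entry of the list.\<close>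

definition join_formula :: "nat \<Rightarrow> (nat set \<Rightarrow> entry formula) \<Rightarrow> entry formula" where
  "join_formula p G = Or (map (\<lambda>c. And (map (\<lambda>J. Or (map (\<lambda>d. G (fiber p c J d))
     (List.n_lists r [False, True]))) (List.n_lists r [0..<l]))) [0..<m])"

text \<open>The three layers have gaps \<open>fib (t + 2)\<close> and \<open>fib (t + 1)\<close>, the longer one first
  iff the Boolean argument is \<open>True\<close>. Cutting the longer gap at the right place yields four
  layers whose first and last three are again of this kind.\<close>

fun walk_formula :: "nat \<Rightarrow> bool \<Rightarrow> nat \<Rightarrow> nat set \<Rightarrow> nat set \<Rightarrow> nat set \<Rightarrow> entry formula" where
  "walk_formula 0 b p A B C = short_formula p A B C"
| "walk_formula (Suc t) True p A B C = join_formula (p + fib (t + 2))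
     (\<lambda>Q. And [walk_formula t True p A Q B, walk_formula t False (p + fib (t + 2)) Q B C])"
| "walk_formula (Suc t) False p A B C = join_formula (p + fib (t + 3))
     (\<lambda>Q. And [walk_formula t True p A B Q, walk_formula t False (p + fib (t + 2)) B Q C])"

text \<open>The two end layers carry singletons, which are monochromatic; guessing the colour of
  layer \<open>fib (t + 2)\<close> supplies the third monochromatic set.\<close>

definition product_formula :: "nat \<Rightarrow> nat \<Rightarrow> nat \<Rightarrow> entry formula" where
  "product_formula t a b =
     Or (map (\<lambda>c. walk_formula t True 0 {a} {v. h (fib (t + 2), v) = c} {b}) [0..<m])"

subsection \<open>Variables, depth and size\<close>

lemma fvars_edge: "u < n \<Longrightarrow> v < n \<Longrightarrow> fvars (edge i u v) \<subseteq> entries k n"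
  by (auto simp: edge_def entries_def)

lemma fvars_short_formula: "fvars (short_formula p A B C) \<subseteq> entries k n"
  unfolding short_formula_def vertices_def
  using fvars_edge by (fastforce simp: subset_iff)

lemma fvars_join_formula:
  assumes "\<And>Q. fvars (G Q) \<subseteq> V"
  shows "fvars (join_formula p G) \<subseteq> V"
  using assms by (auto simp: join_formula_def)

lemma fvars_walk_formula: "fvars (walk_formula t b p A B C) \<subseteq> entries k n"
proof (induction t b p A B C rule: walk_formula.induct)
  case (1 b p A B C)
  then show ?case by (simp add: fvars_short_formula)
next
  case (2 t p A B C)
  then show ?case unfolding walk_formula.simps by (intro fvars_join_formula) simp
next
  case (3 t p A B C)
  then show ?case unfolding walk_formula.simps by (intro fvars_join_formula) simp
qed

lemma fvars_product_formula: "fvars (product_formula t a b) \<subseteq> entries k n"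
  unfolding product_formula_def using fvars_walk_formula by fastforce

lemma depth_Or_le: "(\<And>f. f \<in> set fs \<Longrightarrow> depth f \<le> d) \<Longrightarrow> depth (Or fs) \<le> Suc d"
  by auto

lemma depth_And_le: "(\<And>f. f \<in> set fs \<Longrightarrow> depth f \<le> d) \<Longrightarrow> depth (And fs) \<le> Suc d"
  by auto

lemma depth_short_formula: "depth (short_formula p A B C) \<le> 3"
proof -
  have edge: "depth (edge i u v) \<le> 1" for i u v
    by (simp add: edge_def)
  have "depth (short_formula p A B C) \<le> Suc (Suc 1)"
    unfolding short_formula_def
    by (rule depth_Or_le) (use edge in \<open>auto simp del: depth.simps intro!: depth_And_le\<close>)
  then show ?thesis by simp
qed

lemma depth_join_formula:
  assumes "\<And>Q. depth (G Q) \<le> d"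
  shows "depth (join_formula p G) \<le> d + 3"
proof -
  have "depth (join_formula p G) \<le> Suc (Suc (Suc d))"
    unfolding join_formula_def set_map
    by (intro depth_Or_le depth_And_le)
       (use assms in \<open>auto simp del: depth.simps intro!: depth_Or_le depth_And_le\<close>)
  then show ?thesis by simp
qed

text \<open>Each level adds the three alternations of the join and one binary conjunction.\<close>

lemma depth_walk_formula: "depth (walk_formula t b p A B C) \<le> 4 * t + 3"
proof (induction t b p A B C rule: walk_formula.induct)
  case (1 b p A B C)
  then show ?case by (simp add: depth_short_formula)
next
  case (2 t p A B C)
  then show ?case unfolding walk_formula.simps
    by (intro order_trans[OF depth_join_formula[where d = "Suc (4 * t + 3)"]] depth_And_le)
       (auto simp del: depth.simps)
next
  case (3 t p A B C)
  then show ?case unfolding walk_formula.simps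
    by (intro order_trans[OF depth_join_formula[where d = "Suc (4 * t + 3)"]] depth_And_le)
       (auto simp del: depth.simps)
qed

lemma depth_product_formula: "depth (product_formula t a b) \<le> 4 * t + 4"
proof -
  have "depth (product_formula t a b) \<le> Suc (4 * t + 3)"
    unfolding product_formula_def
    by (intro depth_Or_le) (use depth_walk_formula in auto)
  then show ?thesis by simp
qed

section \<open>Number of gates\<close>

lemma sum_list_gates_le:
  "(\<And>f. f \<in> set fs \<Longrightarrow> gates f \<le> g) \<Longrightarrow> sum_list (map gates fs) \<le> length fs * g"
  by (induction fs) (auto simp: add_mono)

lemma gates_Or_le: "(\<And>f. f \<in> set fs \<Longrightarrow> gates f \<le> g) \<Longrightarrow> gates (Or fs) \<le> 1 + length fs * g"
  using sum_list_gates_le[of fs g] by simp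

lemma gates_And_le: "(\<And>f. f \<in> set fs \<Longrightarrow> gates f \<le> g) \<Longrightarrow> gates (And fs) \<le> 1 + length fs * g"
  using sum_list_gates_le[of fs g] by simp

lemma gates_short_formula: "gates (short_formula p A B C) \<le> 1 + 3 * n ^ 3"
proof -
  have len: "length (vertices A) \<le> n" for A
    unfolding vertices_def by (metis length_filter_le length_upt minus_nat.diff_0)
  let ?fs = "map (\<lambda>(u, v, w). And [edge p u v, edge (Suc p) v w])
    (List.product (vertices A) (List.product (vertices B) (vertices C)))"
  have "length ?fs \<le> n * (n * n)"
    by (simp add: length_product mult_mono len)
  moreover have "gates (And [edge p u v, edge (Suc p) v w]) \<le> 3" for u v w
    by (simp add: edge_def)
  then have "gates (Or ?fs) \<le> 1 + length ?fs * 3"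
    by (intro gates_Or_le) auto
  ultimately show ?thesis
    unfolding short_formula_def by (simp add: power3_eq_cube del: gates.simps)
qed

lemma gates_join_formula:
  assumes "\<And>Q. gates (G Q) \<le> g"
  shows "gates (join_formula p G) \<le> 1 + m * (1 + l ^ r * (1 + 2 ^ r * g))"
proof -
  have 1: "gates (Or (map (\<lambda>d. G (fiber p c J d)) (List.n_lists r [False, True])))
      \<le> 1 + 2 ^ r * g" for c J
    using gates_Or_le[of "map (\<lambda>d. G (fiber p c J d)) (List.n_lists r [False, True])" g] assms
    by (auto simp: length_n_lists numeral_2_eq_2 simp del: gates.simps)
  let ?And = "\<lambda>c. And (map (\<lambda>J. Or (map (\<lambda>d. G (fiber p c J d))
     (List.n_lists r [False, True]))) (List.n_lists r [0..<l]))"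
  have 2: "gates (?And c) \<le> 1 + l ^ r * (1 + 2 ^ r * g)" for c
    by (rule order_trans[OF gates_And_le[where g = "1 + 2 ^ r * g"]])
       (use 1 in \<open>auto simp: length_n_lists simp del: gates.simps\<close>)
  show ?thesis
    unfolding join_formula_def
    by (rule order_trans[OF gates_Or_le[where g = "1 + l ^ r * (1 + 2 ^ r * g)"]])
       (use 2 in \<open>auto simp del: gates.simps\<close>)
qed

text \<open>\<open>L\<close> and \<open>T\<close> stand for \<open>l ^ r\<close> and
  \<open>2 ^ r\<close>, and \<open>1 + 2 * g\<close> for a conjunction of two formulas. As all
  factors are at least 1, the additive ones are absorbed by the constant 6, which makes the size
  recursion purely multiplicative.\<close>

lemma join_size_le:
  fixes g L T :: nat
  assumes "m \<ge> 1" "L \<ge> 1" "T \<ge> 1" "g \<ge> 1"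
  shows "1 + m * (1 + L * (1 + T * (1 + 2 * g))) \<le> 6 * m * (T * L) * g"
proof -
  have "1 + T * (1 + 2 * g) \<le> 4 * (T * g)"
  proof -
    have "1 \<le> T * g" "T \<le> T * g"
      using assms by simp_all
    then have "1 + (T + 2 * (T * g)) \<le> 4 * (T * g)" by linarith
    then show ?thesis by (simp add: algebra_simps)
  qed
  then have "L * (1 + T * (1 + 2 * g)) \<le> L * (4 * (T * g))"
    by (rule mult_le_mono2)
  moreover have "1 \<le> L * (T * g)"
    using assms by simp
  ultimately have "1 + L * (1 + T * (1 + 2 * g)) \<le> 5 * (L * (T * g))"
    by (simp add: algebra_simps)
  then have "m * (1 + L * (1 + T * (1 + 2 * g))) \<le> m * (5 * (L * (T * g)))"
    by (rule mult_le_mono2)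
  moreover have "1 \<le> m * (L * (T * g))"
    using assms by simp
  ultimately show ?thesis
    by (simp add: algebra_simps)
qed

text \<open>For constant \<open>r\<close> and logarithmic \<open>l\<close>, a level of the recursion
  costs a factor \<open>m\<close> up to polylogarithmic terms.\<close>

lemma gates_walk_formula:
  assumes "m \<ge> 1" "l \<ge> 1" "n \<ge> 1"
  shows "gates (walk_formula t b p A B C) \<le> (6 * m * (2 * l) ^ r) ^ t * (4 * n ^ 3)"
proof (induction t b p A B C rule: walk_formula.induct)
  case (1 b p A B C)
  have "n ^ 3 \<ge> 1" using assms by simp
  then show ?case using gates_short_formula[of p A B C] unfolding walk_formula.simps power_0 by linarith
next
  case (2 t p A B C)
  let ?g = "(6 * m * (2 * l) ^ r) ^ t * (4 * n ^ 3)"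
  have "gates (walk_formula (Suc t) True p A B C)
      \<le> 1 + m * (1 + l ^ r * (1 + 2 ^ r * (1 + 2 * ?g)))"
    unfolding walk_formula.simps
  proof (rule gates_join_formula)
    fix Q
    show "gates (And [walk_formula t True p A Q B, walk_formula t False (p + fib (t + 2)) Q B C])
        \<le> 1 + 2 * ?g"
      using 2(1)[of Q] 2(2)[of Q] by (simp only: gates.simps list.map sum_list.Nil sum_list.Cons)
  qed
  also have "\<dots> \<le> 6 * m * (2 ^ r * l ^ r) * ?g"
    by (rule join_size_le) (use assms in auto)
  finally show ?case by (simp add: power_mult_distrib mult.assoc)
next
  case (3 t p A B C)
  let ?g = "(6 * m * (2 * l) ^ r) ^ t * (4 * n ^ 3)"
  have "gates (walk_formula (Suc t) False p A B C)
      \<le> 1 + m * (1 + l ^ r * (1 + 2 ^ r * (1 + 2 * ?g)))"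
    unfolding walk_formula.simps
  proof (rule gates_join_formula)
    fix Q
    show "gates (And [walk_formula t True p A B Q, walk_formula t False (p + fib (t + 2)) B Q C])
        \<le> 1 + 2 * ?g"
      using 3(1)[of Q] 3(2)[of Q] by (simp only: gates.simps list.map sum_list.Nil sum_list.Cons)
  qed
  also have "\<dots> \<le> 6 * m * (2 ^ r * l ^ r) * ?g"
    by (rule join_size_le) (use assms in auto)
  finally show ?case by (simp add: power_mult_distrib mult.assoc)
qed

lemma gates_product_formula:
  assumes "m \<ge> 1" "l \<ge> 1" "n \<ge> 1"
  shows "gates (product_formula t a b) \<le> 8 * m * n ^ 3 * (6 * m * (2 * l) ^ r) ^ t"
proof -
  let ?g = "(6 * m * (2 * l) ^ r) ^ t * (4 * n ^ 3)"
  have "gates (product_formula t a b) \<le> 1 + m * ?g"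
    unfolding product_formula_def
    by (rule order_trans[OF gates_Or_le[where g = ?g]])
       (use gates_walk_formula[OF assms] in \<open>auto simp del: gates.simps\<close>)
  also have "\<dots> \<le> m * ?g + m * ?g"
    using assms by (intro add_right_mono) simp
  also have "\<dots> = 8 * m * n ^ 3 * (6 * m * (2 * l) ^ r) ^ t"
    by simp
  finally show ?thesis .
qed

end

subsection \<open>Correctness\<close>

lemma ex_bit_differs:
  fixes v w :: nat
  assumes "v < 2 ^ l" "w < 2 ^ l" "v \<noteq> w"
  shows "\<exists>j<l. bit v j \<noteq> bit w j"
proof (rule ccontr)
  assume "\<not> ?thesis"
  then have "take_bit l v = take_bit l w"
    by (auto simp: bit_eq_iff bit_take_bit_iff)
  then show False
    using assms by (simp add: take_bit_nat_eq_self)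
qed

text \<open>One position for each pair in \<open>U \<times> W\<close>, at which its two numbers
  differ, makes every pair disagree somewhere on the list. Such a list is what exposes a false
  join.\<close>

lemma ex_separating_bits:
  fixes U W :: "nat set"
  assumes "finite U" "finite W" "U \<inter> W = {}" "card U * card W \<le> r" "l \<ge> 1"
    and "\<And>v. v \<in> U \<union> W \<Longrightarrow> v < 2 ^ l"
  obtains J where "length J = r" "set J \<subseteq> {..<l}"
    "\<And>v w. v \<in> U \<Longrightarrow> w \<in> W \<Longrightarrow> map (bit v) J \<noteq> map (bit w) J"
proof -
  obtain xs where xs: "set xs = U \<times> W" "distinct xs"
    using finite_distinct_list assms(1,2) by (metis finite_SigmaI)
  then have len: "length xs \<le> r"
    using assms(4) distinct_card[OF xs(2)] by (simp add: card_cartesian_product)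
  define \<delta> where "\<delta> = (\<lambda>(v, w). SOME j. j < l \<and> bit (v::nat) j \<noteq> bit (w::nat) j)"
  have \<delta>: "\<delta> (v, w) < l \<and> bit v (\<delta> (v, w)) \<noteq> bit w (\<delta> (v, w))" if "v \<in> U" "w \<in> W" for v w
  proof -
    have "\<exists>j. j < l \<and> bit v j \<noteq> bit w j"
      using ex_bit_differs[of v l w] that assms(3,6) by blast
    then show ?thesis
      unfolding \<delta>_def prod.case by (rule someI_ex)
  qed
  show thesis
  \<comment> \<open>The list is padded to length exactly \<open>r\<close> with position 0, which is
    admissible because \<open>l \<ge> 1\<close>.\<close>
  proof (rule that[of "map \<delta> xs @ replicate (r - length xs) 0"])
    show "length (map \<delta> xs @ replicate (r - length xs) 0) = r"
      using len by simp
    show "set (map \<delta> xs @ replicate (r - length xs) 0) \<subseteq> {..<l}"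
      using \<delta> xs(1) assms(5) by auto
    fix v w assume vw: "v \<in> U" "w \<in> W"
    then have "(v, w) \<in> set xs"
      using xs by simp
    then show "map (bit v) (map \<delta> xs @ replicate (r - length xs) 0)
        \<noteq> map (bit w) (map \<delta> xs @ replicate (r - length xs) 0)"
      using \<delta>[OF vw] by auto
  qed
qed

text \<open>A walk is named by its starting vertex \<open>u\<close> in layer 0; disjointness of the
  walks then becomes injectivity of \<open>walk \<sigma> i\<close> on \<open>{..<n}\<close>.\<close>

primrec walk :: "(nat \<Rightarrow> nat \<Rightarrow> nat) \<Rightarrow> nat \<Rightarrow> nat \<Rightarrow> nat" where
  "walk \<sigma> 0 u = u"
| "walk \<sigma> (Suc i) u = \<sigma> i (walk \<sigma> i u)"

lemma bij_betw_walk: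
  assumes "\<And>i. bij_betw (\<sigma> i) A A"
  shows "bij_betw (walk \<sigma> i) A A"
proof (induction i)
  case 0
  show ?case by (simp add: bij_betw_def inj_on_def)
next
  case (Suc i)
  have "walk \<sigma> (Suc i) = \<sigma> i \<circ> walk \<sigma> i" by auto
  then show ?case using bij_betw_trans[OF Suc assms[of i]] by (simp only:)
qed

text \<open>\<open>\<beta>\<close> is the input, \<open>\<sigma> i\<close> the permutation it
  encodes at step \<open>i\<close>, and \<open>K\<close> the last layer. \<open>small_cells\<close>
  is the property that a random colouring has only with high probability; given it, the formulas are
  exactly correct. \<open>s * s \<le> r\<close> provides one hash position for each pair from two
  sets of at most \<open>s\<close> vertices.\<close>

locale coloured_walks = walk_formulas k n m l r h
  for k n m l r h +
  fixes K s :: nat and \<sigma> :: "nat \<Rightarrow> nat \<Rightarrow> nat" and \<beta> :: "entry \<Rightarrow> bool"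
  assumes bij: "\<And>i. bij_betw (\<sigma> i) {..<n} {..<n}"
    and eval_edge: "\<And>i u v. u < n \<Longrightarrow> v < n \<Longrightarrow> eval_formula \<beta> (edge i u v) \<longleftrightarrow> \<sigma> i u = v"
    and colour: "\<And>p v. p \<le> K \<Longrightarrow> v < n \<Longrightarrow> h (p, v) < m"
    and small_cells: "\<And>p q t c d e. p < q \<Longrightarrow> q < t \<Longrightarrow> t \<le> K \<Longrightarrow> c < m \<Longrightarrow> d < m \<Longrightarrow> e < m \<Longrightarrow>
       card {u \<in> {..<n}. h (p, walk \<sigma> p u) = c \<and> h (q, walk \<sigma> q u) = d \<and> h (t, walk \<sigma> t u) = e} \<le> s"
    and bits: "n \<le> 2 ^ l" "l \<ge> 1" "s * s \<le> r"
begin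

abbreviation "\<pi> \<equiv> walk \<sigma>"

lemma walk_less: "u < n \<Longrightarrow> \<pi> i u < n"
  using bij_betw_walk[of \<sigma> "{..<n}" i] bij by (auto simp: bij_betw_def)

lemma inj_walk: "inj_on (\<pi> i) {..<n}"
  using bij_betw_walk[of \<sigma> "{..<n}" i] bij by (auto simp: bij_betw_def)

lemma ex_walk:
  assumes "v < n"
  shows "\<exists>u<n. \<pi> i u = v"
proof -
  have "\<pi> i ` {..<n} = {..<n}"
    using bij_betw_walk[of \<sigma> "{..<n}" i] bij by (simp add: bij_betw_def)
  then have "v \<in> \<pi> i ` {..<n}"
    using assms by simp
  then show ?thesis by blast
qed

lemma eval_short_formula:
  "eval_formula \<beta> (short_formula p A B C) \<longleftrightarrow>
    (\<exists>u<n. \<pi> p u \<in> A \<and> \<pi> (p + 1) u \<in> B \<and> \<pi> (p + 2) u \<in> C)"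
proof
  assume "eval_formula \<beta> (short_formula p A B C)"
  then obtain x y z where xyz: "x < n" "y < n" "z < n" "x \<in> A" "y \<in> B" "z \<in> C"
    and "eval_formula \<beta> (edge p x y)" "eval_formula \<beta> (edge (Suc p) y z)"
    by (force simp: short_formula_def vertices_def)
  then have "\<sigma> p x = y" "\<sigma> (Suc p) y = z"
    by (simp_all add: eval_edge)
  \<comment> \<open>Every vertex of layer \<open>p\<close> lies on a walk, so the path found extends
    backwards to a start \<open>u\<close>.\<close>
  moreover obtain u where u: "u < n" "\<pi> p u = x"
    using ex_walk xyz(1) by blast
  ultimately have "\<pi> (p + 1) u = y" "\<pi> (p + 2) u = z"
    by simp_all
  with u xyz show "\<exists>u<n. \<pi> p u \<in> A \<and> \<pi> (p + 1) u \<in> B \<and> \<pi> (p + 2) u \<in> C"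
    by blast
next
  assume "\<exists>u<n. \<pi> p u \<in> A \<and> \<pi> (p + 1) u \<in> B \<and> \<pi> (p + 2) u \<in> C"
  then obtain u where u: "u < n" "\<pi> p u \<in> A" "\<pi> (Suc p) u \<in> B" "\<pi> (Suc (Suc p)) u \<in> C"
    by auto
  let ?x = "(\<pi> p u, \<pi> (Suc p) u, \<pi> (Suc (Suc p)) u)"
  have "?x \<in> set (List.product (vertices A) (List.product (vertices B) (vertices C)))"
    using u walk_less[OF u(1), of p] walk_less[OF u(1), of "Suc p"]
      walk_less[OF u(1), of "Suc (Suc p)"]
    by (simp add: vertices_def)
  moreover have "eval_formula \<beta> ((\<lambda>(u, v, w). And [edge p u v, edge (Suc p) v w]) ?x)"
    using walk_less[OF u(1), of p] walk_less[OF u(1), of "Suc p"]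
      walk_less[OF u(1), of "Suc (Suc p)"]
    by (simp add: eval_edge)
  ultimately show "eval_formula \<beta> (short_formula p A B C)"
    unfolding short_formula_def eval_formula.simps set_map by blast
qed

text \<open>A common walk passes all tests with its own colour and bits. Conversely, for a colour
  that passes them, the vertices of that colour on \<open>X\<close>-walks and on
  \<open>Y\<close>-walks form two sets of size at most \<open>s\<close>; were these disjoint, some
  \<open>J\<close> would separate them and its test would fail.\<close>

lemma eval_join_formula:
  assumes p: "p \<le> K"
    and G: "\<And>c J d. c < m \<Longrightarrow> eval_formula \<beta> (G (fiber p c J d)) \<longleftrightarrow>
      (\<exists>u<n. X u \<and> \<pi> p u \<in> fiber p c J d) \<and> (\<exists>u<n. Y u \<and> \<pi> p u \<in> fiber p c J d)"
    and X: "\<And>c. c < m \<Longrightarrow> card {u \<in> {..<n}. X u \<and> h (p, \<pi> p u) = c} \<le> s"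
    and Y: "\<And>c. c < m \<Longrightarrow> card {u \<in> {..<n}. Y u \<and> h (p, \<pi> p u) = c} \<le> s"
  shows "eval_formula \<beta> (join_formula p G) \<longleftrightarrow> (\<exists>u<n. X u \<and> Y u)"
proof
  assume "\<exists>u<n. X u \<and> Y u"
  then obtain u where u: "u < n" "X u" "Y u"
    by blast
  let ?c = "h (p, \<pi> p u)"
  have c: "?c < m"
    using colour p walk_less u(1) by simp
  have "\<exists>d\<in>set (List.n_lists r [False, True]). eval_formula \<beta> (G (fiber p ?c J d))"
    if "J \<in> set (List.n_lists r [0..<l])" for J
  proof
    let ?d = "map (bit (\<pi> p u)) J"
    have "\<pi> p u \<in> fiber p ?c J ?d"
      by (simp add: fiber_def)
    then show "eval_formula \<beta> (G (fiber p ?c J ?d))"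
      unfolding G[OF c] using u by blast
    show "?d \<in> set (List.n_lists r [False, True])"
      using that by (auto simp: set_n_lists)
  qed
  then show "eval_formula \<beta> (join_formula p G)"
    using c by (auto simp: join_formula_def intro!: bexI[of _ ?c])
next
  assume "eval_formula \<beta> (join_formula p G)"
  then obtain c where c: "c < m"
    and *: "\<And>J. J \<in> set (List.n_lists r [0..<l]) \<Longrightarrow> \<exists>d. eval_formula \<beta> (G (fiber p c J d))"
    by (fastforce simp: join_formula_def)
  define U W where "U = \<pi> p ` {u \<in> {..<n}. X u \<and> h (p, \<pi> p u) = c}"
    and "W = \<pi> p ` {u \<in> {..<n}. Y u \<and> h (p, \<pi> p u) = c}"
  have fin: "finite U" "finite W"
    by (auto simp: U_def W_def)
  have "card U \<le> s" "card W \<le> s"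
    using X[OF c] Y[OF c] card_image_le[of "{u \<in> {..<n}. X u \<and> h (p, \<pi> p u) = c}" "\<pi> p"]
      card_image_le[of "{u \<in> {..<n}. Y u \<and> h (p, \<pi> p u) = c}" "\<pi> p"]
    by (auto simp: U_def W_def)
  then have "card U * card W \<le> r"
    using bits(3) mult_le_mono[of "card U" s "card W" s] by linarith
  moreover have "v < 2 ^ l" if "v \<in> U \<union> W" for v
  proof -
    have "v < n"
      using that walk_less by (auto simp: U_def W_def)
    then show ?thesis
      using bits(1) by simp
  qed
  \<comment> \<open>Contrapositive of \<open>ex_separating_bits\<close>: if every \<open>J\<close>
    leaves a colliding pair, the sets intersect.\<close>
  moreover have "U \<inter> W \<noteq> {}" if J: "\<And>J. length J = r \<Longrightarrow> set J \<subseteq> {..<l} \<Longrightarrow>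
      \<exists>v\<in>U. \<exists>w\<in>W. map (bit v) J = map (bit w) J"
    using calculation fin bits(2) ex_separating_bits[of U W r l] J by metis
  moreover have "\<exists>v\<in>U. \<exists>w\<in>W. map (bit v) J = map (bit w) J"
    if "length J = r" "set J \<subseteq> {..<l}" for J
  proof -
    have "J \<in> set (List.n_lists r [0..<l])"
      using that by (auto simp: set_n_lists)
    then obtain d where "eval_formula \<beta> (G (fiber p c J d))"
      using * by blast
    then obtain u w where "u < n" "X u" "\<pi> p u \<in> fiber p c J d" "w < n" "Y w" "\<pi> p w \<in> fiber p c J d"
      unfolding G[OF c] by blast
    then show ?thesis
      by (force simp: U_def W_def fiber_def)
  qed
  ultimately obtain v where "v \<in> U" "v \<in> W"
    by blast
  then obtain u w where "u < n" "X u" "w < n" "Y w" "\<pi> p u = \<pi> p w"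
    by (auto simp: U_def W_def)
  \<comment> \<open>Two walks through the same vertex of layer \<open>p\<close> coincide.\<close>
  then show "\<exists>u<n. X u \<and> Y u"
    using inj_onD[OF inj_walk, of p u w] by auto
qed

text \<open>This is the invariant of the recursion: by \<open>small_cells\<close>, three such sets
  in different layers cut out at most \<open>s\<close> walks.\<close>

definition monochromatic :: "nat \<Rightarrow> nat set \<Rightarrow> bool" where
  "monochromatic p A \<longleftrightarrow> (\<exists>c<m. \<forall>v\<in>A. v < n \<longrightarrow> h (p, v) = c)"

lemma monochromatic_fiber: "c < m \<Longrightarrow> monochromatic p (fiber p c J d)"
  by (auto simp: monochromatic_def fiber_def)

lemma card_cell:
  assumes "p < q" "q < t" "t \<le> K" "monochromatic p A" "monochromatic q B" "monochromatic t C"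
  shows "card {u \<in> {..<n}. \<pi> p u \<in> A \<and> \<pi> q u \<in> B \<and> \<pi> t u \<in> C} \<le> s"
proof -
  obtain c d e where *: "c < m" "d < m" "e < m"
    "\<forall>v\<in>A. v < n \<longrightarrow> h (p, v) = c" "\<forall>v\<in>B. v < n \<longrightarrow> h (q, v) = d" "\<forall>v\<in>C. v < n \<longrightarrow> h (t, v) = e"
    using assms(4-6) unfolding monochromatic_def by blast
  have "card {u \<in> {..<n}. \<pi> p u \<in> A \<and> \<pi> q u \<in> B \<and> \<pi> t u \<in> C}
      \<le> card {u \<in> {..<n}. h (p, \<pi> p u) = c \<and> h (q, \<pi> q u) = d \<and> h (t, \<pi> t u) = e}"
    using * walk_less by (intro card_mono) auto
  also have "\<dots> \<le> s"
    by (rule small_cells) fact+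
  finally show ?thesis .
qed

lemma monochromatic_colour_class: "c < m \<Longrightarrow> monochromatic p {v. h (p, v) = c}"
  by (auto simp: monochromatic_def)

lemma monochromatic_singleton: "p \<le> K \<Longrightarrow> v < n \<Longrightarrow> monochromatic p {v}"
  using colour by (auto simp: monochromatic_def)

abbreviation middle :: "nat \<Rightarrow> bool \<Rightarrow> nat \<Rightarrow> nat" where
  "middle t b p \<equiv> p + (if b then fib (t + 2) else fib (t + 1))"

text \<open>Four layers with gaps \<open>a, b, a\<close> split into triples with gaps
  \<open>a, b\<close> and \<open>b, a\<close>, which share the layer of \<open>B\<close> and the
  guessed layer. Once the guessed colour is fixed, each triple carries three monochromatic sets, so
  the cardinality hypotheses of the join hold.\<close>

lemma eval_walk_formula:
  assumes "p + fib (t + 3) \<le> K"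
    "monochromatic p A" "monochromatic (middle t b p) B" "monochromatic (p + fib (t + 3)) C"
  shows "eval_formula \<beta> (walk_formula t b p A B C) \<longleftrightarrow>
    (\<exists>u<n. \<pi> p u \<in> A \<and> \<pi> (middle t b p) u \<in> B \<and> \<pi> (p + fib (t + 3)) u \<in> C)"
  using assms
proof (induction t b p A B C rule: walk_formula.induct)
  case (1 b p A B C)
  then show ?case
    using eval_short_formula[of p A B C] by (simp add: numeral_eq_Suc)
next
  case (2 t p A B C)
  \<comment> \<open>The four layers are \<open>p\<close>, \<open>p + a\<close>,
    \<open>p + (a + b)\<close> and \<open>p + (a + b + a)\<close>; \<open>B\<close> sits in the
    third and the join guesses in the second.\<close>
  define a b where "a = fib (t + 2)" and "b = fib (t + 1)"
  have fib: "fib (t + 3) = a + b" "fib (Suc t + 3) = a + b + a" "fib (Suc t + 2) = a + b"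
      "fib (Suc t + 1) = a"
    by (simp_all add: a_def b_def numeral_eq_Suc)
  \<comment> \<open>Positive gaps keep the layers distinct, as \<open>card_cell\<close>
    demands.\<close>
  have pos: "a > 0" "b > 0"
    unfolding a_def b_def by (auto intro: fib_neq_0_nat)
  note prems = 2(3-)[unfolded fib if_True, folded a_def b_def]
  note IH = 2(1,2)[folded a_def b_def, unfolded fib if_True if_False, folded a_def b_def]
  define X Y where "X = (\<lambda>u. \<pi> p u \<in> A \<and> \<pi> (p + (a + b)) u \<in> B)"
    and "Y = (\<lambda>u. \<pi> (p + (a + b)) u \<in> B \<and> \<pi> (p + (a + b + a)) u \<in> C)"
  have G: "eval_formula \<beta> (And [walk_formula t True p A Q B, walk_formula t False (p + a) Q B C])
      \<longleftrightarrow> (\<exists>u<n. X u \<and> \<pi> (p + a) u \<in> Q) \<and> (\<exists>u<n. Y u \<and> \<pi> (p + a) u \<in> Q)"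
    if "c < m" "Q = fiber (p + a) c J d" for c J d Q
  proof -
    have Q: "monochromatic (p + a) Q"
      using that monochromatic_fiber by simp
    show ?thesis
      using IH(1)[of Q] IH(2)[of Q] Q prems by (auto simp: X_def Y_def ac_simps)
  qed
  have cX: "card {u \<in> {..<n}. X u \<and> h (p + a, \<pi> (p + a) u) = c} \<le> s" if "c < m" for c
    using card_cell[of p "p + a" "p + (a + b)" A "{v. h (p + a, v) = c}" B]
      monochromatic_colour_class[OF that] prems pos by (simp add: X_def conj_ac)
  have cY: "card {u \<in> {..<n}. Y u \<and> h (p + a, \<pi> (p + a) u) = c} \<le> s" if "c < m" for c
    using card_cell[of "p + a" "p + (a + b)" "p + (a + b + a)" "{v. h (p + a, v) = c}" B C]
      monochromatic_colour_class[OF that] prems pos by (simp add: Y_def conj_ac)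
  have "eval_formula \<beta> (walk_formula (Suc t) True p A B C) \<longleftrightarrow> (\<exists>u<n. X u \<and> Y u)"
    unfolding walk_formula.simps a_def[symmetric]
    by (rule eval_join_formula) (use prems G cX cY in auto)
  then show ?case
    unfolding fib if_True by (auto simp: X_def Y_def)
next
  case (3 t p A B C)
  \<comment> \<open>The mirror case, with the same four layers: \<open>B\<close> sits in the second
    and the join guesses in the third.\<close>
  define a b where "a = fib (t + 2)" and "b = fib (t + 1)"
  have fib: "fib (t + 3) = a + b" "fib (Suc t + 3) = a + b + a" "fib (Suc t + 2) = a + b"
      "fib (Suc t + 1) = a"
    by (simp_all add: a_def b_def numeral_eq_Suc)
  have pos: "a > 0" "b > 0"
    unfolding a_def b_def by (auto intro: fib_neq_0_nat)
  note prems = 3(3-)[unfolded fib if_False, folded a_def b_def]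
  note IH = 3(1,2)[folded a_def b_def, unfolded fib if_True if_False, folded a_def b_def]
  define X Y where "X = (\<lambda>u. \<pi> p u \<in> A \<and> \<pi> (p + a) u \<in> B)"
    and "Y = (\<lambda>u. \<pi> (p + a) u \<in> B \<and> \<pi> (p + (a + b + a)) u \<in> C)"
  have G: "eval_formula \<beta> (And [walk_formula t True p A B Q, walk_formula t False (p + a) B Q C])
      \<longleftrightarrow> (\<exists>u<n. X u \<and> \<pi> (p + (a + b)) u \<in> Q) \<and> (\<exists>u<n. Y u \<and> \<pi> (p + (a + b)) u \<in> Q)"
    if "c < m" "Q = fiber (p + (a + b)) c J d" for c J d Q
  proof -
    have Q: "monochromatic (p + (a + b)) Q"
      using that monochromatic_fiber by simp
    show ?thesis
      using IH(1)[of Q] IH(2)[of Q] Q prems by (auto simp: X_def Y_def ac_simps)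
  qed
  have cX: "card {u \<in> {..<n}. X u \<and> h (p + (a + b), \<pi> (p + (a + b)) u) = c} \<le> s" if "c < m" for c
    using card_cell[of p "p + a" "p + (a + b)" A B "{v. h (p + (a + b), v) = c}"]
      monochromatic_colour_class[OF that] prems pos by (simp add: X_def conj_ac)
  have cY: "card {u \<in> {..<n}. Y u \<and> h (p + (a + b), \<pi> (p + (a + b)) u) = c} \<le> s" if "c < m" for c
    using card_cell[of "p + a" "p + (a + b)" "p + (a + b + a)" B "{v. h (p + (a + b), v) = c}" C]
      monochromatic_colour_class[OF that] prems pos by (simp add: Y_def conj_ac)
  have "eval_formula \<beta> (walk_formula (Suc t) False p A B C) \<longleftrightarrow> (\<exists>u<n. X u \<and> Y u)"
    unfolding walk_formula.simps a_def[symmetric] fib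
    by (rule eval_join_formula) (use prems G cX cY in auto)
  then show ?case
    unfolding fib if_False by (auto simp: X_def Y_def)
qed

text \<open>The condition in layer 0 singles out the walk from \<open>a\<close>, so only the
  disjunct for its true colour in the middle layer can hold.\<close>

lemma eval_product_formula:
  assumes "K = fib (t + 3)" "a < n" "b < n"
  shows "eval_formula \<beta> (product_formula t a b) \<longleftrightarrow> \<pi> K a = b"
proof -
  have le: "fib (t + 2) \<le> K"
    unfolding assms(1) by (intro fib_mono) simp
  have "eval_formula \<beta> (walk_formula t True 0 {a} {v. h (fib (t + 2), v) = c} {b}) \<longleftrightarrow>
      h (fib (t + 2), \<pi> (fib (t + 2)) a) = c \<and> \<pi> K a = b" if "c < m" for c
    using eval_walk_formula[of 0 t "{a}" True "{v. h (fib (t + 2), v) = c}" "{b}"] that assms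
      monochromatic_colour_class monochromatic_singleton by auto
  moreover have "h (fib (t + 2), \<pi> (fib (t + 2)) a) < m"
    using colour le walk_less assms(2) by simp
  ultimately show ?thesis
    unfolding product_formula_def by auto
qed

end

subsection \<open>Permutation matrices\<close>

definition image_index :: "nat \<Rightarrow> int mat \<Rightarrow> nat \<Rightarrow> nat" where
  "image_index n Q a = (THE j. j < n \<and> Q $$ (a, j) = 1)"

lemma image_index:
  assumes "permutation_mat n Q" "a < n"
  shows "image_index n Q a < n"
    and "j < n \<Longrightarrow> Q $$ (a, j) = (if j = image_index n Q a then 1 else 0)"
proof -
  have ex1: "\<exists>!j. j < n \<and> Q $$ (a, j) = 1"
    using assms by (simp add: permutation_mat_def)
  from theI'[OF ex1] show "image_index n Q a < n"
    by (simp add: image_index_def)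
  assume "j < n"
  then have "Q $$ (a, j) = 0 \<or> Q $$ (a, j) = 1"
    using assms by (simp add: permutation_mat_def)
  moreover have "j = image_index n Q a" if "Q $$ (a, j) = 1"
    unfolding image_index_def using the1_equality[OF ex1] that \<open>j < n\<close> by metis
  moreover have "Q $$ (a, image_index n Q a) = 1"
    using theI'[OF ex1] by (simp add: image_index_def)
  ultimately show "Q $$ (a, j) = (if j = image_index n Q a then 1 else 0)"
    by metis
qed

lemma bij_betw_image_index:
  assumes Q: "permutation_mat n Q"
  shows "bij_betw (image_index n Q) {..<n} {..<n}"
proof -
  have "inj_on (image_index n Q) {..<n}"
  proof (rule inj_onI)
    fix a b assume *: "a \<in> {..<n}" "b \<in> {..<n}" "image_index n Q a = image_index n Q b"
    let ?j = "image_index n Q a"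
    have j: "?j < n"
      using image_index(1)[OF Q] *(1) by simp
    then have "Q $$ (a, ?j) = 1" "Q $$ (b, ?j) = 1"
      using image_index(2)[OF Q _ j, of a] image_index(2)[OF Q _ j, of b] * by auto
    moreover have "\<exists>!i. i < n \<and> Q $$ (i, ?j) = 1"
      using Q j by (simp add: permutation_mat_def)
    ultimately show "a = b"
      using * by auto
  qed
  moreover have "image_index n Q ` {..<n} \<subseteq> {..<n}"
    using image_index(1)[OF Q] by auto
  ultimately show ?thesis
    by (simp add: bij_betw_def endo_inj_surj)
qed

text \<open>The continuation by \<open>id\<close> beyond the list matches the constants in
  \<open>edge\<close>.\<close>

definition moves :: "nat \<Rightarrow> int mat list \<Rightarrow> nat \<Rightarrow> nat \<Rightarrow> nat" where
  "moves n Qs i = (if i < length Qs then image_index n (Qs ! i) else id)"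

text \<open>Splits off the first step instead of the last, to match the \<open>foldr\<close> in
  \<open>mat_product\<close>.\<close>

lemma walk_Suc': "walk \<sigma> (Suc i) u = walk (\<lambda>j. \<sigma> (Suc j)) i (\<sigma> 0 u)"
  by (induction i) auto

lemma mat_product_carrier:
  "\<forall>Q\<in>set Qs. permutation_mat n Q \<Longrightarrow> mat_product n Qs \<in> carrier_mat n n"
  by (induction Qs) (auto simp: mat_product_def permutation_mat_def)

lemma mat_product_entry:
  assumes "\<forall>Q\<in>set Qs. permutation_mat n Q" "a < n" "b < n"
  shows "mat_product n Qs $$ (a, b) = (if walk (moves n Qs) (length Qs) a = b then 1 else 0)"
  using assms
proof (induction Qs arbitrary: a)
  case Nil
  then show ?case by (simp add: mat_product_def)
next
  case (Cons Q Qs)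
  have Q: "permutation_mat n Q" and P: "mat_product n Qs \<in> carrier_mat n n"
    using Cons.prems(1) mat_product_carrier by auto
  have Qc: "Q \<in> carrier_mat n n"
    using Q by (simp add: permutation_mat_def)
  let ?j = "image_index n Q a"
  have j: "?j < n"
    using image_index(1)[OF Q] Cons.prems by simp
  have "mat_product n (Q # Qs) $$ (a, b) = (Q * mat_product n Qs) $$ (a, b)"
    by (simp add: mat_product_def)
  also have "\<dots> = (\<Sum>i<n. Q $$ (a, i) * mat_product n Qs $$ (i, b))"
    using Qc P Cons.prems by (simp add: scalar_prod_def lessThan_atLeast0)
  \<comment> \<open>Row \<open>a\<close> of a permutation matrix has a single 1, so one summand
    survives.\<close>
  also have "\<dots> = (\<Sum>i<n. if i = ?j then mat_product n Qs $$ (i, b) else 0)"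
    using image_index(2)[OF Q] Cons.prems by (intro sum.cong) auto
  also have "\<dots> = mat_product n Qs $$ (?j, b)"
    using j by simp
  also have "\<dots> = (if walk (moves n Qs) (length Qs) ?j = b then 1 else 0)"
    using Cons.IH j Cons.prems by simp
  also have "walk (moves n Qs) (length Qs) ?j = walk (moves n (Q # Qs)) (length (Q # Qs)) a"
  proof -
    have "(\<lambda>j. moves n (Q # Qs) (Suc j)) = moves n Qs"
      by (simp add: moves_def fun_eq_iff)
    moreover have "moves n (Q # Qs) 0 a = ?j"
      by (simp add: moves_def)
    ultimately show ?thesis
      using walk_Suc'[of "moves n (Q # Qs)" "length Qs" a] by simp
  qed
  finally show ?case .
qed

lemma walk_moves_beyond:
  assumes "length Qs \<le> i"
  shows "walk (moves n Qs) i a = walk (moves n Qs) (length Qs) a"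
  using assms by (induction rule: dec_induct) (auto simp: moves_def)

subsection \<open>Random colourings\<close>

text \<open>The colours are independent and uniform. \<open>K\<close> steps have
  \<open>K + 1\<close> layers, hence \<open>{..K}\<close>; the 0 is the default value outside the
  index set.\<close>

definition random_colouring :: "nat \<Rightarrow> nat \<Rightarrow> nat \<Rightarrow> (nat \<times> nat \<Rightarrow> nat) pmf" where
  "random_colouring K n m = Pi_pmf ({..K} \<times> {..<n}) 0 (\<lambda>_. pmf_of_set {..<m})"

lemma random_colouring_less:
  assumes "h \<in> set_pmf (random_colouring K n m)" "m \<ge> 1" "p \<le> K" "v < n"
  shows "h (p, v) < m"
proof -
  have "{..<m} \<noteq> {}"
    using assms(2) by (auto simp: lessThan_empty_iff)
  then show ?thesis
    using assms by (auto simp: random_colouring_def set_Pi_pmf PiE_dflt_def)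
qed

text \<open>By independence, each prescribed point contributes a factor \<open>1 / m\<close> and
  every other point a factor 1.\<close>

lemma prob_colouring_agrees:
  assumes m: "m \<ge> 1" and J: "J \<subseteq> {..K} \<times> {..<n}" and f: "\<And>x. x \<in> J \<Longrightarrow> f x < m"
  shows "measure_pmf.prob (random_colouring K n m) {h. \<forall>x\<in>J. h x = f x} = 1 / real m ^ card J"
proof -
  let ?I = "{..K} \<times> {..<n}"
  have ne: "{..<m} \<noteq> {}"
    using m by (auto simp: lessThan_empty_iff)
  have "{h. \<forall>x\<in>J. h x = f x} = Pi ?I (\<lambda>x. if x \<in> J then {f x} else UNIV)"
    using J by (auto simp: Pi_def split: if_splits)
  then have "measure_pmf.prob (random_colouring K n m) {h. \<forall>x\<in>J. h x = f x}
      = (\<Prod>x\<in>?I. measure_pmf.prob (pmf_of_set {..<m}) (if x \<in> J then {f x} else UNIV))"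
    by (simp add: random_colouring_def measure_Pi_pmf_Pi)
  also have "\<dots> = (\<Prod>x\<in>?I. if x \<in> J then 1 / real m else 1)"
    using f ne by (intro prod.cong) (auto simp: measure_pmf_single indicator_def)
  also have "\<dots> = (\<Prod>x\<in>?I \<inter> J. 1 / real m)"
    by (rule prod.inter_restrict[symmetric]) simp
  also have "\<dots> = 1 / real m ^ card J"
    using J by (simp add: Int_absorb1 power_divide)
  finally show ?thesis .
qed

definition large_cell :: "nat \<Rightarrow> nat \<Rightarrow> nat \<Rightarrow> nat \<Rightarrow> (nat \<Rightarrow> nat \<Rightarrow> nat) \<Rightarrow> (nat \<times> nat \<Rightarrow> nat) \<Rightarrow> bool"
  where "large_cell K n m s w h \<longleftrightarrow> (\<exists>p q t c d e. p < q \<and> q < t \<and> t \<le> K \<and> c < m \<and> d < m \<and> e < m \<and>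
    s < card {u \<in> {..<n}. h (p, w p u) = c \<and> h (q, w q u) = d \<and> h (t, w t u) = e})"

text \<open>A union bound over triples of layers, triples of colours and sets \<open>S\<close> of
  \<open>s\<close> walks. For a fixed choice the walks are disjoint, so \<open>3 * s\<close>
  distinct points get prescribed colours, which has probability
  \<open>1 / m ^ (3 * s)\<close>.\<close>

lemma prob_large_cell:
  assumes m: "m \<ge> 1" and s: "s \<ge> 1" and w: "\<And>i. bij_betw (w i) {..<n} {..<n}"
  shows "measure_pmf.prob (random_colouring K n m) {h. large_cell K n m s w h}
    \<le> real (K + 1) ^ 3 * real n ^ s / real m ^ (3 * (s - 1))"
proof -
  let ?M = "measure_pmf (random_colouring K n m)"
  define L where "L = {(p, q, t). p < q \<and> q < t \<and> t \<le> K}"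
  define Z where "Z = {S. S \<subseteq> {..<n} \<and> card S = s}"
  define I where "I = L \<times> ({..<m} \<times> {..<m} \<times> {..<m}) \<times> Z"
  define E where "E = (\<lambda>((p, q, t), (c, d, e), S).
    {h. \<forall>u\<in>S. h (p, w p u) = c \<and> h (q, w q u) = d \<and> h (t, w t u) = (e::nat)})"
  have L: "L \<subseteq> {..K} \<times> {..K} \<times> {..K}"
    by (auto simp: L_def)
  have finL: "finite L"
    by (rule finite_subset[OF L]) auto
  have "card L \<le> card ({..K} \<times> {..K} \<times> {..K})"
    by (rule card_mono[OF _ L]) auto
  then have cardL: "card L \<le> (K + 1) ^ 3"
    by (simp add: card_cartesian_product power3_eq_cube algebra_simps)
  have finZ: "finite Z"
    unfolding Z_def by simp
  have cardZ: "card Z \<le> n ^ s"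
  proof -
    have "card Z = n choose s"
      using n_subsets[of "{..<n}" s] by (simp add: Z_def)
    also have "\<dots> \<le> n ^ s"
      by (cases "s \<le> n") (simp_all add: binomial_le_pow binomial_eq_0)
    finally show ?thesis .
  qed
  have finI: "finite I"
    unfolding I_def using finL finZ by simp
  have cardI: "card I \<le> (K + 1) ^ 3 * (m ^ 3 * n ^ s)"
    unfolding I_def card_cartesian_product
    using cardL cardZ by (intro mult_le_mono) (simp_all add: power3_eq_cube)
  have sub: "{h. large_cell K n m s w h} \<subseteq> (\<Union>i\<in>I. E i)"
  proof
    fix h assume "h \<in> {h. large_cell K n m s w h}"
    then obtain p q t c d e where *: "(p, q, t) \<in> L" "c < m" "d < m" "e < m"
      and "s < card {u \<in> {..<n}. h (p, w p u) = c \<and> h (q, w q u) = d \<and> h (t, w t u) = e}"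
        (is "s < card ?C")
      by (auto simp: large_cell_def L_def)
    then obtain S where S: "S \<subseteq> ?C" "card S = s"
      using obtain_subset_with_card_n[of s ?C] by auto
    then have "((p, q, t), (c, d, e), S) \<in> I"
      using * by (auto simp: I_def Z_def)
    moreover have "h \<in> E ((p, q, t), (c, d, e), S)"
      using S by (auto simp: E_def)
    ultimately show "h \<in> (\<Union>i\<in>I. E i)"
      by blast
  qed
  have prob: "measure ?M (E i) = 1 / real m ^ (3 * s)" if "i \<in> I" for i
  proof -
    obtain p q t c d e S where i: "i = ((p, q, t), (c, d, e), S)"
      by (metis surj_pair)
    then have pqt: "p < q" "q < t" "t \<le> K" and cde: "c < m" "d < m" "e < m"
      and S: "S \<subseteq> {..<n}" "card S = s"
      using that by (auto simp: I_def L_def Z_def)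
    \<comment> \<open>Since \<open>p\<close>, \<open>q\<close> and \<open>t\<close> differ, one
      function can prescribe the colour by layer; \<open>J\<close> collects the points that the
      walks in \<open>S\<close> visit in these layers.\<close>
    define f where "f = (\<lambda>(j, v::nat). if j = p then c else if j = q then d else e)"
    define J where "J = {p} \<times> w p ` S \<union> ({q} \<times> w q ` S \<union> {t} \<times> w t ` S)"
    have inj: "inj_on (w j) S" for j
      using w[of j] S(1) by (auto simp: bij_betw_def intro: inj_on_subset)
    have less: "w j u < n" if "u \<in> S" for j u
      using w[of j] S(1) that by (auto simp: bij_betw_def)
    have finS: "finite S"
      using S(1) finite_subset by blast
    have "card J = card ({p} \<times> w p ` S) + (card ({q} \<times> w q ` S) + card ({t} \<times> w t ` S))"
      unfolding J_def using pqt finS by (subst card_Un_disjoint; (subst card_Un_disjoint)?) auto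
    also have "\<dots> = 3 * s"
      using S(2) by (simp add: card_cartesian_product card_image[OF inj])
    finally have cardJ: "card J = 3 * s" .
    have "E i = {h. \<forall>x\<in>J. h x = f x}"
      using pqt by (auto simp: i E_def J_def f_def)
    moreover have "J \<subseteq> {..K} \<times> {..<n}"
      using pqt less by (auto simp: J_def)
    moreover have "f x < m" for x
      using cde by (auto simp: f_def split: prod.splits)
    ultimately show ?thesis
      using prob_colouring_agrees[OF m, of J K n f] cardJ by simp
  qed
  have "measure ?M {h. large_cell K n m s w h} \<le> measure ?M (\<Union>i\<in>I. E i)"
    using sub by (intro measure_pmf.finite_measure_mono) auto
  also have "\<dots> \<le> (\<Sum>i\<in>I. measure ?M (E i))"
    using finI by (intro measure_pmf.finite_measure_subadditive_finite) auto
  also have "\<dots> = real (card I) / real m ^ (3 * s)"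
    using prob by simp
  also have "\<dots> \<le> real ((K + 1) ^ 3 * (m ^ 3 * n ^ s)) / real m ^ (3 * s)"
    using cardI by (intro divide_right_mono) (simp_all only: of_nat_le_iff zero_le_power of_nat_0_le_iff)
  \<comment> \<open>Split off so that the \<open>m ^ 3\<close> choices of colours cancel; this uses
    \<open>s \<ge> 1\<close>.\<close>
  also have "3 * s = 3 + 3 * (s - 1)"
    using s by simp
  also have "real ((K + 1) ^ 3 * (m ^ 3 * n ^ s)) / real m ^ (3 + 3 * (s - 1))
      = real (K + 1) ^ 3 * real n ^ s / real m ^ (3 * (s - 1))"
    unfolding power_add using m by (simp add: field_simps)
  finally show ?thesis .
qed

subsection \<open>The randomized formula\<close>

definition random_formula ::
  "nat \<Rightarrow> nat \<Rightarrow> nat \<Rightarrow> nat \<Rightarrow> nat \<Rightarrow> nat \<Rightarrow> nat \<Rightarrow> nat \<Rightarrow> entry rformula" where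
  "random_formula k n m l r t a b = map_pmf (\<lambda>h. walk_formulas.product_formula k n m l r h t a b)
     (random_colouring (fib (t + 3)) n m)"

text \<open>Unless the walks of the given input have a large cell, the formula is exactly correct.
  The distribution does not depend on \<open>Qs\<close>; the error is bounded for each input
  separately.\<close>

lemma prob_outputs_random_formula:
  assumes Qs: "length Qs = k" "\<forall>Q\<in>set Qs. permutation_mat n Q"
    and ab: "a < n" "b < n" and k: "k \<le> fib (t + 3)"
    and m: "m \<ge> 1" and s: "s \<ge> 1" and bits: "n \<le> 2 ^ l" "l \<ge> 1" "s * s \<le> r"
  shows "prob_outputs (random_formula k n m l r t a b) (input_bits Qs) (mat_product n Qs $$ (a, b) = 1)
    \<ge> 1 - real (fib (t + 3) + 1) ^ 3 * real n ^ s / real m ^ (3 * (s - 1))"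
proof -
  let ?\<sigma> = "moves n Qs" and ?K = "fib (t + 3)"
  let ?w = "walk ?\<sigma>" and ?M = "random_colouring (fib (t + 3)) n m"
  have bij: "bij_betw (?\<sigma> i) {..<n} {..<n}" for i
    using bij_betw_image_index[of n "Qs ! i"] Qs by (auto simp: moves_def)
  define good where "good = {h. eval_formula (input_bits Qs) (walk_formulas.product_formula k n m l r h t a b)
    = (mat_product n Qs $$ (a, b) = 1)}"
  have "h \<in> good" if h: "h \<in> set_pmf ?M" "\<not> large_cell ?K n m s ?w h" for h
  proof -
    interpret coloured_walks k n m l r h ?K s ?\<sigma> "input_bits Qs"
    proof
      show "eval_formula (input_bits Qs) (walk_formulas.edge k i u v) \<longleftrightarrow> ?\<sigma> i u = v"
        if "u < n" "v < n" for i u v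
        using image_index(2)[of n "Qs ! i" u v] that Qs
        by (auto simp: walk_formulas.edge_def moves_def input_bits_def)
      show "h (p, v) < m" if "p \<le> ?K" "v < n" for p v
        using random_colouring_less[OF h(1) m] that by simp
      show "card {u \<in> {..<n}. h (p, ?w p u) = c \<and> h (q, ?w q u) = d \<and> h (x, ?w x u) = e} \<le> s"
        if "p < q" "q < x" "x \<le> ?K" "c < m" "d < m" "e < m" for p q x c d e
        using h(2) that unfolding large_cell_def by (meson not_le_imp_less)
    qed (fact bij bits)+
    show ?thesis
      using eval_product_formula[of t a b] ab mat_product_entry[OF Qs(2) ab]
        walk_moves_beyond[of Qs ?K n a] k Qs(1)
      by (auto simp: good_def)
  qed
  \<comment> \<open>Outside the support colours may exceed the range below \<open>m\<close>, so the
    inclusion is claimed on the support only.\<close>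
  then have "- good \<inter> set_pmf ?M \<subseteq> {h. large_cell ?K n m s ?w h}"
    by blast
  then have "measure_pmf.prob ?M (- good) \<le> measure_pmf.prob ?M {h. large_cell ?K n m s ?w h}"
    by (subst measure_Int_set_pmf[symmetric]) (intro measure_pmf.finite_measure_mono, auto)
  also have "\<dots> \<le> real (?K + 1) ^ 3 * real n ^ s / real m ^ (3 * (s - 1))"
    by (rule prob_large_cell[OF m s bij_betw_walk]) (rule bij)
  finally have "1 - measure_pmf.prob ?M good \<le> real (?K + 1) ^ 3 * real n ^ s / real m ^ (3 * (s - 1))"
    using measure_pmf.prob_compl[of good ?M] by (simp add: Compl_eq_Diff_UNIV)
  moreover have "prob_outputs (random_formula k n m l r t a b) (input_bits Qs)
      (mat_product n Qs $$ (a, b) = 1) = measure_pmf.prob ?M good"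
    by (simp add: prob_outputs_def random_formula_def good_def measure_map_pmf vimage_def)
  ultimately show ?thesis by linarith
qed

subsection \<open>Asymptotics\<close>

lemma golden_ratio: "golden_ratio > 1" "golden_ratio ^ 2 = golden_ratio + 1"
proof -
  have "sqrt 5 > 1" by simp
  then show "golden_ratio > 1" by (simp add: golden_ratio_def)
  show "golden_ratio ^ 2 = golden_ratio + 1"
    by (simp add: golden_ratio_def power2_eq_square field_simps)
qed

text \<open>The powers of the golden ratio satisfy the Fibonacci recurrence, so comparing two
  initial values suffices.\<close>

lemma golden_ratio_power_le_fib: "golden_ratio ^ t \<le> fib (t + 2)"
proof (induction t rule: fib.induct)
  case 1
  then show ?case by simp
next
  case 2
  have "sqrt 5 \<le> sqrt 9" by (rule real_sqrt_le_mono) simp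
  then show ?case by (simp add: golden_ratio_def numeral_eq_Suc)
next
  case (3 t)
  have "golden_ratio ^ Suc (Suc t) = golden_ratio ^ t * golden_ratio ^ 2"
    by (simp add: power2_eq_square)
  also have "\<dots> = golden_ratio ^ Suc t + golden_ratio ^ t"
    by (simp add: golden_ratio(2) algebra_simps)
  also have "\<dots> \<le> fib (Suc t + 2) + fib (t + 2)"
    using 3 by simp
  finally show ?case by simp
qed

lemma Suc_le_fib: "Suc t \<le> fib (t + 2)"
proof (induction t)
  case (Suc t)
  have "fib (Suc t) > 0" by (rule fib_neq_0_nat) simp
  with Suc show ?case by simp
qed simp

text \<open>Take the least \<open>t\<close>. If it is positive, minimality gives
  \<open>fib (t + 2) < k\<close>, and this Fibonacci number dominates
  \<open>golden_ratio ^ t\<close>. It bounds the number of recursion levels.\<close>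

lemma ex_fib_level:
  assumes "k \<ge> 1"
  obtains t where "k \<le> fib (t + 3)" "real t \<le> log golden_ratio (real k)"
proof -
  define t where "t = (LEAST t. k \<le> fib (t + 3))"
  have "k \<le> fib (k + 3)"
    using Suc_le_fib[of "Suc k"] by (simp add: numeral_eq_Suc)
  then have t: "k \<le> fib (t + 3)"
    unfolding t_def by (rule LeastI)
  have "golden_ratio ^ t \<le> real k"
  proof (cases t)
    case 0
    then show ?thesis using assms by simp
  next
    case (Suc t')
    then have "\<not> k \<le> fib (t' + 3)"
      using not_less_Least[of t' "\<lambda>t. k \<le> fib (t + 3)"] by (simp add: t_def)
    then have "real (fib (t + 2)) \<le> real k"
      by (simp add: Suc numeral_eq_Suc)
    with golden_ratio_power_le_fib[of t] show ?thesis by linarith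
  qed
  then have "golden_ratio powr t \<le> real k"
    using golden_ratio(1) by (simp add: powr_realpow)
  then have "real t \<le> log golden_ratio (real k)"
    using golden_ratio(1) assms by (simp add: le_log_iff)
  with t that show thesis by blast
qed

text \<open>The 12 is the 6 of the size recursion times the 2 lost in rounding up the number of
  colours.\<close>

lemma eventually_polylog_le:
  assumes "\<delta> > 0"
  shows "eventually (\<lambda>n::nat. 12 * (2 * real (nat \<lceil>log 2 n\<rceil>)) ^ r \<le> real n powr \<delta>) sequentially"
proof -
  have "eventually (\<lambda>n::nat. 12 * (2 * (log 2 n + 1)) ^ r \<le> real n powr \<delta>) sequentially"
    using assms by real_asymp
  moreover have "eventually (\<lambda>n::nat. n \<ge> 1) sequentially"
    by (rule eventually_ge_at_top)
  ultimately show ?thesis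
  proof eventually_elim
    case (elim n)
    have "real (nat \<lceil>log 2 n\<rceil>) \<le> log 2 n + 1"
      using elim(2) by simp
    then have "(2 * real (nat \<lceil>log 2 n\<rceil>)) ^ r \<le> (2 * (log 2 n + 1)) ^ r"
      by (intro power_mono) auto
    with elim(1) show ?case by simp
  qed
qed

text \<open>The surplus \<open>1 / (t + 1)\<close> over the exponent \<open>1 / 3\<close> lets a
  cell bound \<open>s\<close> independent of \<open>n\<close> suffice, yet over \<open>t\<close>
  levels it adds at most 1 to the exponent of the size.\<close>

definition colours :: "nat \<Rightarrow> nat \<Rightarrow> nat" where
  "colours t n = nat \<lceil>real n powr (1 / 3 + 1 / (real t + 1))\<rceil>"

lemma colours_bounds:
  assumes "n \<ge> 1"
  shows "real n powr (1 / 3 + 1 / (real t + 1)) \<le> colours t n"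
    and "colours t n \<le> 2 * real n powr (1 / 3 + 1 / (real t + 1))"
    and "colours t n \<ge> 1"
proof -
  have "real n powr (1 / 3 + 1 / (real t + 1)) \<ge> 1"
    using assms by (intro ge_one_powr_ge_zero) auto
  then show "real n powr (1 / 3 + 1 / (real t + 1)) \<le> colours t n"
    "colours t n \<le> 2 * real n powr (1 / 3 + 1 / (real t + 1))" "colours t n \<ge> 1"
    unfolding colours_def by linarith+
qed

text \<open>The exponent is made up of 1 for the constant 16 (using \<open>n \<ge> 16\<close>),
  \<open>1 / 3 + \<delta>\<close> for the outermost colour guess, 3 for the base case and
  \<open>(1 / 3 + 2 * \<delta>) * t\<close> for the levels, where \<open>2 * \<delta>\<close> covers
  the colour surplus and the polylogarithmic factor. As \<open>\<delta> \<le> 1\<close> and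
  \<open>\<delta> * t \<le> 1\<close>, the constant 8 is enough.\<close>

lemma size_bound:
  assumes n: "n \<ge> 16" and polylog: "12 * (2 * real l) ^ r \<le> real n powr (1 / (real t + 1))"
  shows "real (8 * colours t n * n ^ 3 * (6 * colours t n * (2 * l) ^ r) ^ t) \<le> real n powr (1 / 3 * t + 8)"
proof -
  define \<delta> where "\<delta> = 1 / (real t + 1)"
  define m where "m = real (colours t n)"
  have \<delta>: "\<delta> \<le> 1" "\<delta> * t \<le> 1"
    by (simp_all add: \<delta>_def field_simps)
  have m: "m \<le> 2 * real n powr (1 / 3 + \<delta>)" "m \<ge> 0"
    using colours_bounds(2)[of n t] n by (simp_all add: m_def \<delta>_def add.commute)
  have "6 * m * (2 * real l) ^ r \<le> real n powr (1 / 3 + \<delta>) * (12 * (2 * real l) ^ r)"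
    using mult_right_mono[OF m(1), of "6 * (2 * real l) ^ r"] by (simp add: algebra_simps)
  also have "\<dots> \<le> real n powr (1 / 3 + \<delta>) * real n powr \<delta>"
    using polylog by (intro mult_left_mono) (simp_all add: \<delta>_def add.commute)
  also have "\<dots> = real n powr (1 / 3 + 2 * \<delta>)"
    by (simp add: powr_add[symmetric] add.commute)
  finally have "(6 * m * (2 * real l) ^ r) ^ t \<le> (real n powr (1 / 3 + 2 * \<delta>)) ^ t"
    using m by (intro power_mono) auto
  also have "\<dots> = real n powr ((1 / 3 + 2 * \<delta>) * t)"
    using n powr_power[of "real n" "1 / 3 + 2 * \<delta>" t] by (simp only: mult.commute)
  finally have 1: "(6 * m * (2 * real l) ^ r) ^ t \<le> real n powr ((1 / 3 + 2 * \<delta>) * t)" .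
  have "8 * m \<le> 16 * real n powr (1 / 3 + \<delta>)"
    using m by simp
  also have "\<dots> \<le> real n powr 1 * real n powr (1 / 3 + \<delta>)"
    using n by (intro mult_right_mono) simp_all
  finally have "8 * m * n ^ 3 \<le> real n powr 1 * real n powr (1 / 3 + \<delta>) * real n powr 3"
    using n powr_realpow[of "real n" 3] by (simp add: mult_right_mono)
  with 1 have "8 * m * n ^ 3 * (6 * m * (2 * real l) ^ r) ^ t \<le>
      real n powr 1 * real n powr (1 / 3 + \<delta>) * real n powr 3 * real n powr ((1 / 3 + 2 * \<delta>) * t)"
    by (intro mult_mono[of "8 * m * n ^ 3"]) (use m in simp_all)
  also have "\<dots> = real n powr (1 + (1 / 3 + \<delta>) + 3 + (1 / 3 + 2 * \<delta>) * t)"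
    by (simp only: powr_add)
  also have "\<dots> \<le> real n powr (1 / 3 * t + 8)"
    using n \<delta> by (intro powr_mono) (simp_all add: algebra_simps)
  finally show ?thesis
    by (simp add: m_def)
qed

text \<open>With \<open>\<delta> = 1 / (t + 1)\<close> the choice of \<open>s\<close> gives
  \<open>\<delta> * s = 2\<close>, so the denominator has order at least \<open>n\<close> to the
  power \<open>s - 1 + 6 - 3 * \<delta>\<close>, and this exponent is at least
  \<open>s + 2\<close>.\<close>

lemma error_bound:
  assumes n: "n \<ge> 1" and s: "s = 2 * (t + 1)"
  shows "real n ^ s / real (colours t n) ^ (3 * (s - 1)) \<le> 1 / real n ^ 2"
proof -
  define \<delta> where "\<delta> = 1 / (real t + 1)"
  have "\<delta> * (t + 1) = 1"
    by (simp add: \<delta>_def)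
  moreover have "\<delta> \<le> 1"
    by (simp add: \<delta>_def)
  ultimately have exponent: "real s + 2 \<le> (1 / 3 + \<delta>) * real (3 * (s - 1))"
    using s by (simp add: algebra_simps)
  have "real n ^ s * real n ^ 2 = real n powr (real s + 2)"
    using n powr_realpow[of "real n" "s + 2"] by (simp only: power_add[symmetric] of_nat_add) simp
  also have "\<dots> \<le> real n powr ((1 / 3 + \<delta>) * real (3 * (s - 1)))"
    by (rule powr_mono[OF exponent]) (use n in simp)
  also have "\<dots> = (real n powr (1 / 3 + \<delta>)) ^ (3 * (s - 1))"
    using n powr_power[of "real n" "1 / 3 + \<delta>" "3 * (s - 1)"] by (simp only: mult.commute)
  also have "\<dots> \<le> real (colours t n) ^ (3 * (s - 1))"
    using colours_bounds(1)[OF n, of t] by (intro power_mono) (simp_all add: \<delta>_def add.commute)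
  finally show ?thesis
    using n colours_bounds(3)[OF n, of t] by (simp add: field_simps)
qed

text \<open>\<open>t\<close>, and with it \<open>s\<close> and the depth \<open>4 * t + 4\<close>,
  depends on \<open>k\<close> alone. The error \<open>\<epsilon> n\<close> is uniform over inputs
  and entries, and the absolute constant 8 comes from \<open>size_bound\<close>.\<close>

theorem theorem1p10:
  shows "\<exists>c::real. \<forall>k::nat. k \<ge> 1 \<longrightarrow>
    (\<exists>(d::nat) (\<epsilon>::nat \<Rightarrow> real). \<epsilon> \<longlonglongrightarrow> 0 \<and>
      (\<forall>n::nat. \<exists>F :: nat \<Rightarrow> nat \<Rightarrow> entry rformula.
        (\<forall>a<n. \<forall>b<n. \<forall>f\<in>set_pmf (F a b).
          fvars f \<subseteq> entries k n \<and>
          depth f \<le> d \<and>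
          real (gates f) \<le> real n powr (1 / 3 * log golden_ratio (real k) + c)) \<and>
        (\<forall>Qs. length Qs = k \<and> (\<forall>Q\<in>set Qs. permutation_mat n Q) \<longrightarrow>
          (\<forall>a<n. \<forall>b<n.
            prob_outputs (F a b) (input_bits Qs) (mat_product n Qs $$ (a, b) = 1) \<ge> 1 - \<epsilon> n))))"
proof (intro exI[of _ "8::real"] allI impI)
  fix k :: nat assume "k \<ge> 1"
  then obtain t where k: "k \<le> fib (t + 3)" and t: "real t \<le> log golden_ratio (real k)"
    by (rule ex_fib_level)
  define s where "s = 2 * (t + 1)"
  define l where "l = (\<lambda>n::nat. nat \<lceil>log 2 n\<rceil>)"
  define C where "C = real (fib (t + 3) + 1) ^ 3"
  obtain N where N: "\<And>n. n \<ge> N \<Longrightarrow> 12 * (2 * real (l n)) ^ (s * s) \<le> real n powr (1 / (real t + 1))"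
    using eventually_polylog_le[of "1 / (real t + 1)" "s * s"]
    by (auto simp: eventually_sequentially l_def)
  define \<epsilon> where "\<epsilon> = (\<lambda>n. if n < max N 16 then 1 else C / real n ^ 2)"
  define F where "F = (\<lambda>n a b. if n < max N 16 then return_pmf (And [])
    else random_formula k n (colours t n) (l n) (s * s) t a b)"
  have "(\<lambda>n. C / real n ^ 2) \<longlonglongrightarrow> 0"
    by real_asymp
  moreover have "eventually (\<lambda>n. C / real n ^ 2 = \<epsilon> n) sequentially"
    using eventually_ge_at_top[of "max N 16"] by eventually_elim (auto simp: \<epsilon>_def)
  ultimately have \<epsilon>: "\<epsilon> \<longlonglongrightarrow> 0"
    by (rule Lim_transform_eventually)
  have exponent: "1 / 3 * real t + 8 \<le> 1 / 3 * log golden_ratio (real k) + 8"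
    using t by simp
  have size: "fvars f \<subseteq> entries k n \<and> depth f \<le> 4 * t + 4 \<and>
      real (gates f) \<le> real n powr (1 / 3 * log golden_ratio (real k) + 8)"
    if "a < n" "b < n" "f \<in> set_pmf (F n a b)" for n a b f
  proof (cases "n < max N 16")
    case True
    \<comment> \<open>A single gate fits the bound: \<open>a < n\<close> forces
      \<open>n \<ge> 1\<close>, and the exponent is nonnegative by \<open>t\<close>.\<close>
    moreover have "1 \<le> real n powr (1 / 3 * log golden_ratio (real k) + 8)"
      using that(1) t by (intro ge_one_powr_ge_zero) auto
    ultimately show ?thesis
      using that by (simp add: F_def)
  next
    case False
    then have n: "n \<ge> 16" "n \<ge> N" by auto
    have "log 2 n > 0" using n by simp
    then have l: "l n \<ge> 1"
      unfolding l_def by linarith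
    from that False obtain h where
      f: "f = walk_formulas.product_formula k n (colours t n) (l n) (s * s) h t a b"
      by (auto simp: F_def random_formula_def)
    have "real (gates f) \<le>
        real (8 * colours t n * n ^ 3 * (6 * colours t n * (2 * l n) ^ (s * s)) ^ t)"
      unfolding f of_nat_le_iff
      by (rule walk_formulas.gates_product_formula) (use colours_bounds(3) l n in auto)
    also have "\<dots> \<le> real n powr (1 / 3 * t + 8)"
      by (rule size_bound[OF n(1) N[OF n(2)]])
    also have "\<dots> \<le> real n powr (1 / 3 * log golden_ratio (real k) + 8)"
      by (rule powr_mono[OF exponent]) (use n in simp)
    finally show ?thesis
      unfolding f using walk_formulas.fvars_product_formula walk_formulas.depth_product_formula
      by blast
  qed
  have correct: "prob_outputs (F n a b) (input_bits Qs) (mat_product n Qs $$ (a, b) = 1) \<ge> 1 - \<epsilon> n"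
    if "length Qs = k" "\<forall>Q\<in>set Qs. permutation_mat n Q" "a < n" "b < n" for n Qs a b
  proof (cases "n < max N 16")
    case True
    then show ?thesis
      by (simp add: \<epsilon>_def prob_outputs_def)
  next
    case False
    then have n: "n \<ge> 16" "n \<ge> N" by auto
    have "log 2 n > 0" using n by simp
    then have l: "l n \<ge> 1"
      unfolding l_def by linarith
    have "real n = 2 powr log 2 n"
      using n by simp
    also have "\<dots> \<le> 2 powr real (l n)"
      unfolding l_def by (intro powr_mono) (simp_all add: real_nat_ceiling_ge)
    also have "\<dots> = real (2 ^ l n)"
      by (simp add: powr_realpow)
    finally have bits: "n \<le> 2 ^ l n"
      by (simp only: of_nat_le_iff)
    have "C * real n ^ s / real (colours t n) ^ (3 * (s - 1)) \<le> C / real n ^ 2"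
      using mult_left_mono[OF error_bound[of n s t], of C] n by (simp add: s_def C_def)
    moreover have "1 - C * real n ^ s / real (colours t n) ^ (3 * (s - 1))
        \<le> prob_outputs (random_formula k n (colours t n) (l n) (s * s) t a b) (input_bits Qs)
          (mat_product n Qs $$ (a, b) = 1)"
      unfolding C_def
      by (rule prob_outputs_random_formula)
         (use that k l n bits colours_bounds(3)[of n t] in \<open>auto simp: s_def\<close>)
    ultimately show ?thesis
      using False by (simp add: F_def \<epsilon>_def)
  qed
  show "\<exists>(d::nat) (\<epsilon>::nat \<Rightarrow> real). \<epsilon> \<longlonglongrightarrow> 0 \<and>
      (\<forall>n::nat. \<exists>F :: nat \<Rightarrow> nat \<Rightarrow> entry rformula.
        (\<forall>a<n. \<forall>b<n. \<forall>f\<in>set_pmf (F a b).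
          fvars f \<subseteq> entries k n \<and>
          depth f \<le> d \<and>
          real (gates f) \<le> real n powr (1 / 3 * log golden_ratio (real k) + 8)) \<and>
        (\<forall>Qs. length Qs = k \<and> (\<forall>Q\<in>set Qs. permutation_mat n Q) \<longrightarrow>
          (\<forall>a<n. \<forall>b<n.
            prob_outputs (F a b) (input_bits Qs) (mat_product n Qs $$ (a, b) = 1) \<ge> 1 - \<epsilon> n)))"
    using \<epsilon> size correct by (intro exI[of _ "4 * t + 4"] exI[of _ \<epsilon>] conjI allI exI[of _ "F n" for n]) blast+
qed

end
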